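(* Let $a,b\in C^1(\mathbb{R})$ be real-valued with $b_0:=\inf_{z\in\mathbb{R}}b(z)>0$ and $\partial_za,\partial_zb\in L^\infty(\mathbb{R})$. Then there exists a constant $\mathscr{C}>0$ such that all normalized solutions $y(x,z,t)=(u(x,z,t),v(x,z,t))^T$ of the system $$\partial_tu=-a(z)\partial_xu+b(z)\partial_x^2u,$$ $$\partial_tv=-(\partial_za(z))\partial_xu+(\partial_zb(z))\partial_x^2u-a(z)\partial_xv+b(z)\partial_x^2v,$$ with $x\in\mathbb{T}^1$, $z\in\mathbb{R}$, $t\ge 0$, and with steady state $y^\infty:=(1,0)^T$, satisfy $$\sup_{z\in\mathbb{R}}\|y(\cdot,z,t)-y^\infty\|^2_{L^2(0,2\pi;\mathbb{R}^2)}\le\mathscr{C}(1+t^2)e^{-2b_0t}\sup_{z\in\mathbb{R}}\|y(\cdot,z,0)-y^\infty\|^2_{L^2(0,2\pi;\mathbb{R}^2)},\qquad t\ge 0.$$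
   Context: $\mathbb{T}^1$ is the one-dimensional torus of length $2\pi$. Here $u(x,z,t)\in\mathbb{R}$ solves the first equation with initial datum $u(x,z,0)=u^0(x,z)$, where $z\in\mathbb{R}$ is a parameter, and $v:=\partial_zu$ is its parameter derivative, which solves the second equation with initial datum $v^0=\partial_zu^0$. "Normalized" means $\frac1{2\pi}\int_0^{2\pi}u^0(x,z)\,dx=1$ for all $z\in\mathbb{R}$, and consequently $\int_0^{2\pi}v^0(x,z)\,dx=0$ for all $z\in\mathbb{R}$. The constant $\mathscr{C}$ is independent of the solution, of $z$ and of $t$. *)

theory Defs
  imports "HOL-Analysis.Analysis"
begin

text \<open>
  Functions of \<open>(x, z, t)\<close>, with \<open>x\<close> in the torus of length \<open>2\<pi>\<close>, are curried functions on
  \<open>\<real> \<times> \<real> \<times> \<real>\<close> that are \<open>2\<pi>\<close>-periodic in \<open>x\<close>; only times \<open>t \<ge> 0\<close> matter.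
\<close>

definition dx :: "(real \<Rightarrow> real \<Rightarrow> real \<Rightarrow> real) \<Rightarrow> real \<Rightarrow> real \<Rightarrow> real \<Rightarrow> real" where
  "dx f x z t = deriv (\<lambda>s. f s z t) x"

definition dt :: "(real \<Rightarrow> real \<Rightarrow> real \<Rightarrow> real) \<Rightarrow> real \<Rightarrow> real \<Rightarrow> real \<Rightarrow> real" where
  "dt f x z t = deriv (\<lambda>s. f x z s) t"

text \<open>Extended-real valued, so that suprema over \<open>z\<close> are meaningful when infinite. On
  \<^typ>\<open>real \<times> real\<close> the norm is the Euclidean one.\<close>

definition L2_norm_sq :: "(real \<Rightarrow> 'a::real_normed_vector) \<Rightarrow> ennreal" where
  "L2_norm_sq f = (\<integral>\<^sup>+ x\<in>{0..2*pi}. ennreal ((norm (f x))\<^sup>2) \<partial>lborel)"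

definition L2_torus :: "(real \<Rightarrow> real) set" where
  "L2_torus = {f. f \<in> borel_measurable borel \<and> (\<forall>x. f (x + 2*pi) = f x) \<and> L2_norm_sq f < \<infinity>}"

text \<open>
  For each \<open>z\<close>: \<open>f(\<cdot>,z,\<cdot>)\<close> is in \<open>C([0,\<infinity>); L\<^sup>2)\<close> and is of class \<open>C\<^sup>2\<close> in \<open>x\<close> and \<open>C\<^sup>1\<close>
  in \<open>t\<close> for \<open>t > 0\<close>. Since the equations are parabolic, every \<open>L\<^sup>2\<close> initial datum has a
  solution in this class; no smoothness is imposed at \<open>t = 0\<close>, where the datum is attained in
  \<open>L\<^sup>2\<close>. Continuity into \<open>L\<^sup>2\<close> at times \<open>t > 0\<close> follows from joint continuity.
\<close>

definition parabolic_class :: "(real \<Rightarrow> real \<Rightarrow> real \<Rightarrow> real) \<Rightarrow> bool" where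
  "parabolic_class f \<longleftrightarrow>
     (\<forall>z. \<forall>t\<ge>0. (\<lambda>x. f x z t) \<in> L2_torus) \<and>
     (\<forall>z. ((\<lambda>t. L2_norm_sq (\<lambda>x. f x z t - f x z 0)) \<longlongrightarrow> 0) (at_right 0)) \<and>
     (\<forall>x z. \<forall>t>0. (\<lambda>s. f s z t) differentiable (at x) \<and>
                  (\<lambda>s. dx f s z t) differentiable (at x) \<and>
                  (\<lambda>s. f x z s) differentiable (at t)) \<and>
     (\<forall>z. \<forall>g\<in>{f, dx f, dx (dx f), dt f}.
        continuous_on (UNIV \<times> {0<..}) (\<lambda>(x, t). g x z t))"

text \<open>\<open>v = \<partial>\<^sub>z u\<close> with the difference quotients converging in \<open>L\<^sup>2\<close>; at \<open>t = 0\<close> this is the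
  relation between the initial data. A merely pointwise derivative would not yield the mean-zero
  property of \<open>v\<close> at \<open>t = 0\<close> from the normalization of \<open>u\<close>.\<close>

definition parameter_derivative ::
  "(real \<Rightarrow> real \<Rightarrow> real \<Rightarrow> real) \<Rightarrow> (real \<Rightarrow> real \<Rightarrow> real \<Rightarrow> real) \<Rightarrow> bool" where
  "parameter_derivative u v \<longleftrightarrow>
     (\<forall>z. \<forall>t\<ge>0. ((\<lambda>h. L2_norm_sq (\<lambda>x. (u x (z + h) t - u x z t) / h - v x z t)) \<longlongrightarrow> 0) (at 0))"

definition sensitivity_solution ::
  "(real \<Rightarrow> real) \<Rightarrow> (real \<Rightarrow> real) \<Rightarrow>
   (real \<Rightarrow> real \<Rightarrow> real \<Rightarrow> real) \<Rightarrow> (real \<Rightarrow> real \<Rightarrow> real \<Rightarrow> real) \<Rightarrow> bool" where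
  "sensitivity_solution a b u v \<longleftrightarrow>
     parabolic_class u \<and> parabolic_class v \<and> parameter_derivative u v \<and>
     (\<forall>x z. \<forall>t>0.
        dt u x z t = - a z * dx u x z t + b z * dx (dx u) x z t \<and>
        dt v x z t = - deriv a z * dx u x z t + deriv b z * dx (dx u) x z t
                     - a z * dx v x z t + b z * dx (dx v) x z t)"

definition normalized :: "(real \<Rightarrow> real \<Rightarrow> real \<Rightarrow> real) \<Rightarrow> bool" where
  "normalized u \<longleftrightarrow> (\<forall>z. 1 / (2*pi) * (LBINT x:{0..2*pi}. u x z 0) = 1)"

end

theory Submission
  imports Defs
begin

text \<open>
  An energy argument for each fixed \<open>z\<close>. Write \<open>E\<^sub>u = \<parallel>u - 1\<parallel>\<^sup>2\<close>, \<open>E\<^sub>v = \<parallel>v\<parallel>\<^sup>2\<close>, \<open>P\<^sub>u = \<parallel>\<partial>\<^sub>x u\<parallel>\<^sup>2\<close>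
  and let \<open>M\<close> bound the derivatives of \<open>a\<close> and \<open>b\<close>. Both means are conserved, so Wirtinger's
  inequality with optimal constant 1 gives \<open>E\<^sub>u' \<le> - 2 b\<^sub>0 P\<^sub>u\<close>, \<open>E\<^sub>u \<le> P\<^sub>u\<close> and, for every
  \<open>\<eta> \<le> 2 b\<^sub>0\<close>, \<open>E\<^sub>v' \<le> - (2 b\<^sub>0 - \<eta>) E\<^sub>v + (4 M\<^sup>2 / \<eta>) P\<^sub>u\<close>. The loss \<open>\<eta>\<close> in the rate is harmless
  on \<open>[s, t]\<close> when \<open>1 / \<eta> = 1 / (2 b\<^sub>0) + (t - s)\<close>, which produces the factor quadratic in \<open>t\<close>.
  Solutions are smooth only for positive times, so the estimate is obtained from \<open>s > 0\<close> on and
  \<open>s\<close> tends to 0 afterwards.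
\<close>

section \<open>Wirtinger's inequality\<close>

lemma periodic_deriv:
  fixes f :: "real \<Rightarrow> real"
  assumes der: "\<And>x. (f has_real_derivative f' x) (at x)" and per: "\<And>x. f (x + p) = f x"
  shows "f' (x + p) = f' x"
proof -
  have "((\<lambda>x. f (x + p)) has_real_derivative f' (x + p)) (at x)"
    using der[of "x + p"] DERIV_shift by blast
  then show ?thesis using der[of x] per by (simp add: DERIV_unique)
qed

lemma integral_periodic_shift:
  fixes f :: "real \<Rightarrow> real"
  assumes cont: "continuous_on UNIV f" and per: "\<And>x. f (x + p) = f x" and "p \<ge> 0"
  shows "integral {c..c + p} f = integral {0..p} f"
proof -
  have int: "f integrable_on {x..y}" for x y
    using cont by (intro integrable_continuous_real) (rule continuous_on_subset, auto)
  have shift: "integral {x + p..y + p} f = integral {x..y} f" for x y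
    using integral_shift_real_ivl[of "x + p" p "y + p" f] per by simp
  show ?thesis
  \<comment> \<open>Overlapping intervals are split in two ways, and the leftover pieces are
    translates of each other by the period \<open>p\<close>. The sign of \<open>c\<close> only
    decides the order of the endpoints, so \<open>c\<close> may exceed \<open>p\<close>.\<close>
  proof (cases "c \<ge> 0")
    case True
    have "integral {0..c} f + integral {c..c + p} f = integral {0..c + p} f"
      using True \<open>p \<ge> 0\<close> int by (intro Henstock_Kurzweil_Integration.integral_combine) auto
    moreover have "integral {0..p} f + integral {p..c + p} f = integral {0..c + p} f"
      using True \<open>p \<ge> 0\<close> int by (intro Henstock_Kurzweil_Integration.integral_combine) auto
    moreover have "integral {p..c + p} f = integral {0..c} f"
      using shift[of 0 c] by simp
    ultimately show ?thesis by simp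
  next
    case False
    have "integral {c..0} f + integral {0..p} f = integral {c..p} f"
      using False \<open>p \<ge> 0\<close> int by (intro Henstock_Kurzweil_Integration.integral_combine) auto
    moreover have "integral {c..c + p} f + integral {c + p..p} f = integral {c..p} f"
      using False \<open>p \<ge> 0\<close> int by (intro Henstock_Kurzweil_Integration.integral_combine) auto
    moreover have "integral {c + p..p} f = integral {c..0} f"
      using shift[of c 0] by simp
    ultimately show ?thesis by simp
  qed
qed

text \<open>With \<open>\<phi> = - \<lambda> tan (\<lambda> (x - c - \<pi>/2))\<close> one has \<open>\<phi>' = - \<lambda>\<^sup>2 - \<phi>\<^sup>2\<close>, hence
  \<open>(\<phi> h\<^sup>2)' = h'\<^sup>2 - \<lambda>\<^sup>2 h\<^sup>2 - (h' - \<phi> h)\<^sup>2\<close>. Taking \<open>\<lambda> < 1\<close> keeps \<open>\<phi>\<close> regular at the endpoints.\<close>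

lemma dirichlet_poincare:
  fixes h h' :: "real \<Rightarrow> real"
  assumes der: "\<And>x. (h has_real_derivative h' x) (at x)" and cont: "continuous_on UNIV h'"
    and zero: "h c = 0" "h (c + pi) = 0"
  shows "integral {c..c + pi} (\<lambda>x. (h x)\<^sup>2) \<le> integral {c..c + pi} (\<lambda>x. (h' x)\<^sup>2)"
proof -
  have ch: "continuous_on S h" for S
    using der by (meson DERIV_isCont continuous_at_imp_continuous_on)
  have ch': "continuous_on S h'" for S
    using cont continuous_on_subset by blast
  have less: "l\<^sup>2 * integral {c..c + pi} (\<lambda>x. (h x)\<^sup>2) \<le> integral {c..c + pi} (\<lambda>x. (h' x)\<^sup>2)"
    if l: "0 < l" "l < 1" for l :: real
  proof -
    define \<phi> where "\<phi> x = - l * tan (l * (x - c - pi / 2))" for x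
    have cosnz: "cos (l * (x - c - pi / 2)) \<noteq> 0" if "x \<in> {c..c + pi}" for x
    proof -
      have "\<bar>x - c - pi / 2\<bar> \<le> pi / 2"
        using that unfolding atLeastAtMost_iff abs_le_iff by linarith
      then have "\<bar>l * (x - c - pi / 2)\<bar> \<le> l * (pi / 2)"
        unfolding abs_mult using l by (intro mult_mono) auto
      also have "\<dots> < pi / 2" using l pi_gt_zero by simp
      finally show ?thesis using cos_gt_zero_pi[of "l * (x - c - pi / 2)"]
        unfolding abs_less_iff by linarith
    qed
    have d\<phi>: "(\<phi> has_real_derivative (- l\<^sup>2 - (\<phi> x)\<^sup>2)) (at x)" if "x \<in> {c..c + pi}" for x
    proof -
      let ?y = "l * (x - c - pi / 2)"
      have "inverse ((cos ?y)\<^sup>2) = 1 + (tan ?y)\<^sup>2"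
        using tan_sec[OF cosnz[OF that]] by (simp add: power_inverse)
      then have "- l * (inverse ((cos ?y)\<^sup>2) * l) = - l\<^sup>2 - (\<phi> x)\<^sup>2"
        by (simp add: \<phi>_def power_mult_distrib) (simp add: power2_eq_square algebra_simps)
      then show ?thesis unfolding \<phi>_def
        using cosnz[OF that] by (auto intro!: derivative_eq_intros simp: mult_ac)
    qed
    \<comment> \<open>The boundary terms of the fundamental theorem carry the factor
      \<open>h\<close>, which vanishes at both endpoints, so this integral is 0.\<close>
    have "((\<lambda>x. (h' x)\<^sup>2 - l\<^sup>2 * (h x)\<^sup>2 - (h' x - \<phi> x * h x)\<^sup>2) has_integral
        (\<phi> (c + pi) * (h (c + pi))\<^sup>2 - \<phi> c * (h c)\<^sup>2)) {c..c + pi}"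
    proof (rule fundamental_theorem_of_calculus)
      fix x assume x: "x \<in> {c..c + pi}"
      have "((\<lambda>x. \<phi> x * (h x)\<^sup>2) has_real_derivative
          (h' x)\<^sup>2 - l\<^sup>2 * (h x)\<^sup>2 - (h' x - \<phi> x * h x)\<^sup>2) (at x)"
        by (auto intro!: derivative_eq_intros d\<phi>[OF x] der simp: power2_eq_square algebra_simps)
      then show "((\<lambda>x. \<phi> x * (h x)\<^sup>2) has_vector_derivative
          (h' x)\<^sup>2 - l\<^sup>2 * (h x)\<^sup>2 - (h' x - \<phi> x * h x)\<^sup>2) (at x within {c..c + pi})"
        using has_field_derivative_at_within has_real_derivative_iff_has_vector_derivative by blast
    qed auto
    then have I: "((\<lambda>x. (h' x)\<^sup>2 - l\<^sup>2 * (h x)\<^sup>2 - (h' x - \<phi> x * h x)\<^sup>2) has_integral 0) {c..c + pi}"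
      using zero by simp
    have int: "(\<lambda>x. (h x)\<^sup>2) integrable_on {c..c + pi}" "(\<lambda>x. (h' x)\<^sup>2) integrable_on {c..c + pi}"
      by (auto intro!: integrable_continuous_real continuous_intros ch ch')
    have J: "((\<lambda>x. (h' x)\<^sup>2 - l\<^sup>2 * (h x)\<^sup>2) has_integral
        integral {c..c + pi} (\<lambda>x. (h' x)\<^sup>2) - l\<^sup>2 * integral {c..c + pi} (\<lambda>x. (h x)\<^sup>2)) {c..c + pi}"
      using int by (intro has_integral_diff has_integral_mult_right integrable_integral)
    \<comment> \<open>The integrand of \<open>J\<close> exceeds that of \<open>I\<close> by a
      square, so its integral is nonnegative.\<close>
    show ?thesis
      using has_integral_le[OF I J] by simp
  qed
  \<comment> \<open>Letting \<open>l\<close> tend to 1 from below recovers the sharp constant 1,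
    which the optimal decay rate requires.\<close>
  have lim: "((\<lambda>l. l\<^sup>2 * integral {c..c + pi} (\<lambda>x. (h x)\<^sup>2)) \<longlongrightarrow>
      1\<^sup>2 * integral {c..c + pi} (\<lambda>x. (h x)\<^sup>2)) (at_left 1)"
    by (intro tendsto_intros)
  have ev: "\<forall>\<^sub>F l in at_left 1. l\<^sup>2 * integral {c..c + pi} (\<lambda>x. (h x)\<^sup>2)
      \<le> integral {c..c + pi} (\<lambda>x. (h' x)\<^sup>2)"
    using less unfolding eventually_at_left_field by (auto intro!: exI[of _ 0])
  show ?thesis
    using tendsto_upperbound[OF lim ev] by simp
qed

text \<open>A \<open>2\<pi>\<close>-periodic function takes the same value at some \<open>c\<close> and at \<open>c + \<pi>\<close>, so that
  \<open>f - f c\<close> satisfies Dirichlet conditions on both half periods.\<close>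

lemma wirtinger:
  fixes f f' :: "real \<Rightarrow> real"
  assumes der: "\<And>x. (f has_real_derivative f' x) (at x)" and cont: "continuous_on UNIV f'"
    and per: "\<And>x. f (x + 2 * pi) = f x" and mean: "integral {0..2 * pi} f = 0"
  shows "integral {0..2 * pi} (\<lambda>x. (f x)\<^sup>2) \<le> integral {0..2 * pi} (\<lambda>x. (f' x)\<^sup>2)"
proof -
  have cf: "continuous_on S f" for S
    using der by (meson DERIV_isCont continuous_at_imp_continuous_on)
  have cf': "continuous_on S f'" for S
    using cont continuous_on_subset by blast
  have per': "f' (x + 2 * pi) = f' x" for x
    using der per by (rule periodic_deriv)
  obtain c where c: "f (c + pi) = f c"
  proof -
    \<comment> \<open>Periodicity forces \<open>g pi = - g 0\<close>, so \<open>g\<close> changes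
      sign on the half period and the intermediate value theorem applies, increasing or decreasing
      according to the sign of \<open>g 0\<close>.\<close>
    define g where "g x = f (x + pi) - f x" for x
    have "g pi = - g 0" using per[of 0] by (simp add: g_def)
    moreover have "continuous_on {0..pi} g"
      unfolding g_def by (auto intro!: continuous_intros continuous_on_compose2[OF cf])
    ultimately have "\<exists>x. g x = 0"
      using IVT'[of g 0 0 pi] IVT2'[of g pi 0 0] by (cases "g 0 \<le> 0") auto
    then show ?thesis using that by (auto simp: g_def)
  qed
  have c2: "f (c + pi + pi) = f c" using per[of c] by (simp add: add.assoc)
  define h where "h x = f x - f c" for x
  have dh: "(h has_real_derivative f' x) (at x)" for x
    unfolding h_def by (auto intro!: derivative_eq_intros der)
  have ch: "continuous_on S h" for S
    unfolding h_def by (intro continuous_intros cf)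
  have int: "(\<lambda>x. (h x)\<^sup>2) integrable_on {x..y}" "(\<lambda>x. (f' x)\<^sup>2) integrable_on {x..y}"
    "(\<lambda>x. (f x)\<^sup>2) integrable_on {x..y}" "f integrable_on {x..y}" for x y
    by (auto intro!: integrable_continuous_real continuous_intros cf cf' ch)
  have shift: "integral {c..c + pi + pi} (\<lambda>x. (g x)\<^sup>2) = integral {0..2 * pi} (\<lambda>x. (g x)\<^sup>2)"
    if "continuous_on UNIV g" "\<And>x. g (x + 2 * pi) = g x" for g :: "real \<Rightarrow> real"
    using integral_periodic_shift[of "\<lambda>x. (g x)\<^sup>2" "2 * pi" c] that
    by (simp add: add.assoc continuous_on_power)
  \<comment> \<open>Since \<open>f\<close> has mean zero, the cross term integrates to 0.
    Subtracting the constant \<open>f c\<close> can therefore only enlarge the integral of the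
    square.\<close>
  have "(\<lambda>x. (h x)\<^sup>2) = (\<lambda>x. (f x)\<^sup>2 - 2 * f c * f x + (f c)\<^sup>2)"
    by (auto simp: h_def power2_eq_square algebra_simps)
  then have "integral {0..2 * pi} (\<lambda>x. (h x)\<^sup>2)
      = integral {0..2 * pi} (\<lambda>x. (f x)\<^sup>2 - 2 * f c * f x + (f c)\<^sup>2)" by simp
  also have "\<dots> = integral {0..2 * pi} (\<lambda>x. (f x)\<^sup>2) - 2 * f c * integral {0..2 * pi} f
      + 2 * pi * (f c)\<^sup>2"
    using int by (intro integral_unique has_integral_add has_integral_diff has_integral_mult_right
        integrable_integral) (use has_integral_const_real[of "(f c)\<^sup>2" 0 "2 * pi"] in auto)
  finally have "integral {0..2 * pi} (\<lambda>x. (f x)\<^sup>2) \<le> integral {0..2 * pi} (\<lambda>x. (h x)\<^sup>2)"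
    using mean by simp
  also have "\<dots> = integral {c..c + pi + pi} (\<lambda>x. (h x)\<^sup>2)"
    using per ch by (intro shift[symmetric]) (simp_all add: h_def)
  also have "\<dots> = integral {c..c + pi} (\<lambda>x. (h x)\<^sup>2) + integral {c + pi..c + pi + pi} (\<lambda>x. (h x)\<^sup>2)"
    using int by (subst Henstock_Kurzweil_Integration.integral_combine) auto
  also have "\<dots> \<le> integral {c..c + pi} (\<lambda>x. (f' x)\<^sup>2) + integral {c + pi..c + pi + pi} (\<lambda>x. (f' x)\<^sup>2)"
    by (intro add_mono dirichlet_poincare dh cont) (simp_all only: h_def c c2 diff_self)
  also have "\<dots> = integral {c..c + pi + pi} (\<lambda>x. (f' x)\<^sup>2)"
    using int by (subst Henstock_Kurzweil_Integration.integral_combine) auto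
  also have "\<dots> = integral {0..2 * pi} (\<lambda>x. (f' x)\<^sup>2)"
    using per' cont by (intro shift) auto
  finally show ?thesis .
qed

section \<open>Energy estimates\<close>

text \<open>The first bound holds because the weighted energy
  \<open>exp (k * (r - s)) * Eu r\<close> is nonincreasing. For the second, no pointwise upper bound
  on the dissipation \<open>Pu\<close> is available. Its weighted time integral is bounded instead:
  the differential inequality for \<open>Eu\<close> pays for it, at a cost growing linearly in
  \<open>t - s\<close>. The second power of the time comes from \<open>1 / \<eta>\<close>.\<close>

lemma energy_gronwall:
  fixes Eu Ev Pu du dv :: "real \<Rightarrow> real"
  assumes k: "k > 0" and st: "s \<le> t"
    and Eu: "\<And>r. s \<le> r \<Longrightarrow> (Eu has_real_derivative du r) (at r)"
    and Ev: "\<And>r. s \<le> r \<Longrightarrow> (Ev has_real_derivative dv r) (at r)"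
    and du: "\<And>r. s \<le> r \<Longrightarrow> du r \<le> - k * Pu r"
    and dv: "\<And>r \<eta>. s \<le> r \<Longrightarrow> 0 < \<eta> \<Longrightarrow> \<eta> \<le> k \<Longrightarrow> dv r \<le> - (k - \<eta>) * Ev r + N / \<eta> * Pu r"
    and Pu: "\<And>r. s \<le> r \<Longrightarrow> Eu r \<le> Pu r"
    and nn: "\<And>r. s \<le> r \<Longrightarrow> 0 \<le> Eu r" "\<And>r. s \<le> r \<Longrightarrow> 0 \<le> Ev r" and N: "N \<ge> 0"
  shows "Eu t \<le> exp (- k * (t - s)) * Eu s"
    and "Ev t \<le> exp 1 * exp (- k * (t - s)) * (Ev s + N * (1 / k + (t - s))\<^sup>2 * Eu s)"
proof -
  define G where "G r = exp (k * (r - s)) * Eu r" for r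
  have dG: "(G has_real_derivative exp (k * (r - s)) * (k * Eu r + du r)) (at r)" if "s \<le> r" for r
    unfolding G_def by (auto intro!: derivative_eq_intros Eu that simp: algebra_simps)
  have Gmono: "G r \<le> G s" if "s \<le> r" for r
  proof (rule DERIV_nonpos_imp_nonincreasing[OF that])
    fix x assume x: "s \<le> x"
    have "k * Eu x \<le> k * Pu x" using Pu[OF x] k by simp
    then have "k * Eu x + du x \<le> 0" using du[OF x] by linarith
    then show "\<exists>y. (G has_real_derivative y) (at x) \<and> y \<le> 0"
      using dG[OF x] by (meson exp_ge_zero mult_nonneg_nonpos)
  qed
  have Gs: "G s = Eu s" by (simp add: G_def)
  have scale: "y \<le> exp (- k * x) * z" if "exp (k * x) * y \<le> z" for x y z
    using mult_left_mono[OF that, of "exp (- k * x)"]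
    by (simp add: mult.assoc[symmetric] exp_add[symmetric])
  show "Eu t \<le> exp (- k * (t - s)) * Eu s"
    using Gmono[OF st] by (intro scale) (simp add: G_def)

  define \<tau> where "\<tau> = t - s"
  \<comment> \<open>This choice stays in the admissible range up to \<open>k\<close> and gives
    \<open>\<eta> * \<tau> \<le> 1\<close>, so restoring the full rate \<open>k\<close> at the end
    costs at most the factor \<open>exp 1\<close>.\<close>
  define \<eta> where "\<eta> = k / (1 + k * \<tau>)"
  have \<tau>: "\<tau> \<ge> 0" using st by (simp add: \<tau>_def)
  have p: "1 + k * \<tau> > 0" using k \<tau> by (simp add: add_pos_nonneg)
  have \<eta>: "0 < \<eta>" "\<eta> \<le> k"
    using k \<tau> p by (auto simp: \<eta>_def divide_le_eq)
  have \<eta>\<tau>: "\<eta> * \<tau> \<le> 1" using p by (simp add: \<eta>_def divide_le_eq)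
  have inv\<eta>: "1 / \<eta> = 1 / k + \<tau>" using k by (simp add: \<eta>_def add_divide_distrib)
  \<comment> \<open>The derivative of \<open>G r / k\<close> is at most
    \<open>Eu s - exp (k * (r - s)) * Pu r\<close>. After subtracting \<open>Eu s * (r - s)\<close>,
    what remains is negative dissipation, which cancels the source term in the inequality for
    \<open>Ev\<close>.\<close>
  define Q where "Q r = exp ((k - \<eta>) * (r - s)) * Ev r
      + N / \<eta> * (G r / k - Eu s * (r - s))" for r
  have "Q t \<le> Q s"
  proof (rule DERIV_nonpos_imp_nonincreasing[OF st])
    fix r assume r: "s \<le> r"
    let ?e = "exp ((k - \<eta>) * (r - s))" and ?E = "exp (k * (r - s))"
    let ?y = "?e * ((k - \<eta>) * Ev r + dv r) + N / \<eta> * (?E * (k * Eu r + du r) / k - Eu s)"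
    have dQ: "(Q has_real_derivative ?y) (at r)"
      unfolding Q_def using k \<eta>(1)
      by (auto intro!: derivative_eq_intros Ev dG r) (simp add: field_simps)
    have P0: "Pu r \<ge> 0" using Pu[OF r] nn(1)[OF r] by linarith
    have N\<eta>: "N / \<eta> \<ge> 0" using N \<eta> by simp
    have "?e * ((k - \<eta>) * Ev r + dv r) \<le> ?e * (N / \<eta> * Pu r)"
      using dv[OF r \<eta>] by (intro mult_left_mono) (auto simp: algebra_simps)
    \<comment> \<open>The weight is enlarged to the one with rate \<open>k\<close>, so that the
      dissipation here matches the one produced by \<open>G\<close>.\<close>
    also have "\<dots> \<le> ?E * (N / \<eta> * Pu r)"
      using P0 N\<eta> \<eta> r by (intro mult_right_mono mult_nonneg_nonneg) (auto intro!: mult_right_mono)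
    finally have 1: "?e * ((k - \<eta>) * Ev r + dv r) \<le> N / \<eta> * (?E * Pu r)" by (simp add: mult_ac)
    have "?E * (k * Eu r + du r) / k \<le> ?E * (k * Eu r - k * Pu r) / k"
      using du[OF r] k by (intro divide_right_mono mult_left_mono) auto
    also have "\<dots> = G r - ?E * Pu r" using k by (simp add: G_def field_simps)
    finally have "?E * (k * Eu r + du r) / k - Eu s \<le> - (?E * Pu r)"
      using Gmono[OF r] Gs by linarith
    then have "N / \<eta> * (?E * (k * Eu r + du r) / k - Eu s) \<le> N / \<eta> * - (?E * Pu r)"
      using N\<eta> by (intro mult_left_mono)
    then have "?y \<le> 0" using 1 by (simp del: times_divide_eq_left)
    then show "\<exists>y. (Q has_real_derivative y) (at r) \<and> y \<le> 0" using dQ by blast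
  qed
  moreover have "G t / k \<ge> 0" using nn(1)[OF st] k by (simp add: G_def)
  then have "N / \<eta> * (G t / k) \<ge> 0" using N \<eta> by (intro mult_nonneg_nonneg) auto
  ultimately have "exp ((k - \<eta>) * \<tau>) * Ev t \<le> Ev s + N / \<eta> * (Eu s / k) + N / \<eta> * (Eu s * \<tau>)"
    by (simp add: Q_def Gs \<tau>_def right_diff_distrib)
  also have "\<dots> = Ev s + N * (1 / \<eta>) * Eu s * (1 / k + \<tau>)"
    by (simp add: algebra_simps add_divide_distrib)
  also have "\<dots> = Ev s + N * (1 / k + \<tau>)\<^sup>2 * Eu s"
    unfolding inv\<eta> by (simp add: power2_eq_square)
  finally have 2: "exp ((k - \<eta>) * \<tau>) * Ev t \<le> Ev s + N * (1 / k + \<tau>)\<^sup>2 * Eu s" .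
  have "exp (k * \<tau>) * Ev t = exp (\<eta> * \<tau>) * (exp ((k - \<eta>) * \<tau>) * Ev t)"
    by (simp only: mult.assoc[symmetric] exp_add[symmetric]) (simp add: left_diff_distrib)
  also have "\<dots> \<le> exp 1 * (Ev s + N * (1 / k + \<tau>)\<^sup>2 * Eu s)"
    using 2 \<eta>\<tau> nn st by (intro mult_mono) auto
  finally have "Ev t \<le> exp (- k * \<tau>) * (exp 1 * (Ev s + N * (1 / k + \<tau>)\<^sup>2 * Eu s))"
    by (rule scale)
  then show "Ev t \<le> exp 1 * exp (- k * (t - s)) * (Ev s + N * (1 / k + (t - s))\<^sup>2 * Eu s)"
    unfolding \<tau>_def by (simp only: mult_ac)
qed

section \<open>Integration of periodic functions and differentiation under the integral sign\<close>

lemma has_integral_deriv_periodic: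
  fixes f :: "real \<Rightarrow> real"
  assumes der: "\<And>x. (f has_real_derivative f' x) (at x)" and per: "\<And>x. f (x + p) = f x"
    and "p \<ge> 0"
  shows "(f' has_integral 0) {0..p}"
proof -
  have "(f has_vector_derivative f' x) (at x within {0..p})" for x
    using has_field_derivative_at_within[OF der]
    by (simp add: has_real_derivative_iff_has_vector_derivative)
  then have "(f' has_integral f p - f 0) {0..p}"
    using \<open>p \<ge> 0\<close> by (intro fundamental_theorem_of_calculus)
  then show ?thesis using per[of 0] by simp
qed

lemma periodic_integration_by_parts:
  fixes f g :: "real \<Rightarrow> real"
  assumes f: "\<And>x. (f has_real_derivative f' x) (at x)" "\<And>x. f (x + p) = f x"
    and g: "\<And>x. (g has_real_derivative g' x) (at x)" "\<And>x. g (x + p) = g x"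
    and cont: "continuous_on {0..p} f'" and "p \<ge> 0"
  shows "((\<lambda>x. f x * g' x) has_integral - integral {0..p} (\<lambda>x. f' x * g x)) {0..p}"
proof -
  have "((\<lambda>x. f x * g x) has_real_derivative f' x * g x + f x * g' x) (at x)" for x
    using DERIV_mult'[OF f(1)[of x] g(1)[of x]] by (simp add: add.commute)
  then have "((\<lambda>x. f' x * g x + f x * g' x) has_integral 0) {0..p}"
    by (rule has_integral_deriv_periodic) (simp_all add: f(2) g(2) \<open>p \<ge> 0\<close>)
  moreover have "continuous_on {0..p} g"
    by (intro continuous_at_imp_continuous_on ballI DERIV_isCont[OF g(1)])
  then have "(\<lambda>x. f' x * g x) integrable_on {0..p}"
    using cont by (intro integrable_continuous_real continuous_on_mult)
  ultimately have "((\<lambda>x. f' x * g x + f x * g' x - f' x * g x) has_integral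
      0 - integral {0..p} (\<lambda>x. f' x * g x)) {0..p}"
    by (intro has_integral_diff integrable_integral)
  then show ?thesis by simp
qed

text \<open>The Leibniz rule is applied on the convex set of positive times. As this set is open,
  the derivative within it is the full derivative.\<close>

lemma leibniz_positive_times:
  fixes g g' :: "real \<Rightarrow> real \<Rightarrow> real"
  assumes der: "\<And>x t. t > 0 \<Longrightarrow> (g x has_real_derivative g' x t) (at t)"
    and slice: "\<And>t. t > 0 \<Longrightarrow> continuous_on {a..b} (\<lambda>x. g x t)"
    and cont: "continuous_on (UNIV \<times> {0<..}) (\<lambda>(x, t). g' x t)" and "t > 0"
  shows "((\<lambda>t. integral {a..b} (\<lambda>x. g x t)) has_real_derivative
    integral {a..b} (\<lambda>x. g' x t)) (at t)"
proof -
  have "continuous_on ({0<..} \<times> cbox a b) (\<lambda>p. case (snd p, fst p) of (x, t) \<Rightarrow> g' x t)"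
    by (rule continuous_on_compose2[OF cont]) (auto intro!: continuous_intros)
  then have joint: "continuous_on ({0<..} \<times> cbox a b) (\<lambda>(t, x). g' x t)"
    by (simp add: case_prod_unfold)
  have "((\<lambda>t. integral (cbox a b) (\<lambda>x. g x t)) has_field_derivative
      integral (cbox a b) (\<lambda>x. g' x t)) (at t within {0<..})"
  proof (rule leibniz_rule_field_derivative
      [where U = "{0<..}" and f = "\<lambda>s x. g x s" and fx = "\<lambda>s x. g' x s"])
    show "((\<lambda>s. g x s) has_field_derivative g' x s) (at s within {0<..})" if "s \<in> {0<..}" for s x
      using der that by (auto intro: has_field_derivative_at_within)
    show "(\<lambda>x. g x s) integrable_on cbox a b" if "s \<in> {0<..}" for s
      using slice that by (auto intro: integrable_continuous_real)
  qed (use \<open>t > 0\<close> joint in auto)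
  moreover have "at t within {0<..} = at t"
    using \<open>t > 0\<close> by (intro at_within_open) auto
  ultimately show ?thesis by simp
qed

section \<open>Energy, dissipation and mean of one smooth periodic function\<close>

text \<open>The derivatives are separate parameters so that \<open>w\<close> can later be
  \<open>u - 1\<close> while the derivatives remain syntactically those of \<open>u\<close>.\<close>

locale periodic_C21 =
  fixes w wx wxx wt :: "real \<Rightarrow> real \<Rightarrow> real"
  assumes der_x: "\<And>x t. t > 0 \<Longrightarrow> ((\<lambda>s. w s t) has_real_derivative wx x t) (at x)"
    and der_xx: "\<And>x t. t > 0 \<Longrightarrow> ((\<lambda>s. wx s t) has_real_derivative wxx x t) (at x)"
    and der_t: "\<And>x t. t > 0 \<Longrightarrow> (w x has_real_derivative wt x t) (at t)"
    and per: "\<And>x t. t > 0 \<Longrightarrow> w (x + 2 * pi) t = w x t"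
    and cont_w: "continuous_on (UNIV \<times> {0<..}) (\<lambda>(x, t). w x t)"
    and cont_wx: "continuous_on (UNIV \<times> {0<..}) (\<lambda>(x, t). wx x t)"
    and cont_wxx: "continuous_on (UNIV \<times> {0<..}) (\<lambda>(x, t). wxx x t)"
    and cont_wt: "continuous_on (UNIV \<times> {0<..}) (\<lambda>(x, t). wt x t)"
begin

definition energy :: "real \<Rightarrow> real" where
  "energy t = integral {0..2 * pi} (\<lambda>x. (w x t)\<^sup>2)"

definition dissipation :: "real \<Rightarrow> real" where
  "dissipation t = integral {0..2 * pi} (\<lambda>x. (wx x t)\<^sup>2)"

definition mean :: "real \<Rightarrow> real" where
  "mean t = integral {0..2 * pi} (\<lambda>x. w x t)"

lemma continuous_slice:
  assumes "t > 0"
  shows "continuous_on S (\<lambda>x. w x t)" "continuous_on S (\<lambda>x. wx x t)"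
    "continuous_on S (\<lambda>x. wxx x t)" "continuous_on S (\<lambda>x. wt x t)"
proof -
  have "continuous_on S (\<lambda>x. case (x, t) of (x, t) \<Rightarrow> g x t)"
    if "continuous_on (UNIV \<times> {0<..}) (\<lambda>(x, t). g x t)" for g :: "real \<Rightarrow> real \<Rightarrow> real"
    by (rule continuous_on_compose2[OF that]) (use assms in \<open>auto intro!: continuous_intros\<close>)
  then show "continuous_on S (\<lambda>x. w x t)" "continuous_on S (\<lambda>x. wx x t)"
    "continuous_on S (\<lambda>x. wxx x t)" "continuous_on S (\<lambda>x. wt x t)"
    using cont_w cont_wx cont_wxx cont_wt by auto
qed

lemma per_x: "t > 0 \<Longrightarrow> wx (x + 2 * pi) t = wx x t"
  using der_x per by (rule periodic_deriv)

text \<open>This covers all real times: where the square is not integrable, the integral takes its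
  default value 0.\<close>

lemma energy_nonneg: "energy t \<ge> 0"
  unfolding energy_def
  by (cases "(\<lambda>x. (w x t)\<^sup>2) integrable_on {0..2 * pi}")
    (simp_all add: integral_nonneg not_integrable_integral)

lemma dissipation_nonneg: "dissipation t \<ge> 0"
  unfolding dissipation_def
  by (cases "(\<lambda>x. (wx x t)\<^sup>2) integrable_on {0..2 * pi}")
    (simp_all add: integral_nonneg not_integrable_integral)

lemma energy_le_dissipation:
  assumes "t > 0" "mean t = 0"
  shows "energy t \<le> dissipation t"
  using assms unfolding energy_def dissipation_def mean_def
  by (intro wirtinger der_x continuous_slice per)

lemma mean_deriv:
  "t > 0 \<Longrightarrow> (mean has_real_derivative integral {0..2 * pi} (\<lambda>x. wt x t)) (at t)"
  unfolding mean_def[abs_def]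
  by (rule leibniz_positive_times[OF der_t continuous_slice(1) cont_wt])

lemma energy_deriv:
  assumes "t > 0"
  shows "(energy has_real_derivative 2 * integral {0..2 * pi} (\<lambda>x. w x t * wt x t)) (at t)"
proof -
  have "((\<lambda>s. (w x s)\<^sup>2) has_real_derivative 2 * (w x t * wt x t)) (at t)" if "t > 0" for x t
    using DERIV_power[OF der_t[OF that, of x], of 2] by (simp add: mult_ac)
  moreover have "continuous_on {0..2 * pi} (\<lambda>x. (w x t)\<^sup>2)" if "t > 0" for t
    using that by (intro continuous_intros continuous_slice)
  moreover have "continuous_on (UNIV \<times> {0<..}) (\<lambda>(x, t). 2 * (w x t * wt x t))"
    using cont_w cont_wt unfolding case_prod_unfold by (intro continuous_intros)
  ultimately have "((\<lambda>t. integral {0..2 * pi} (\<lambda>x. (w x t)\<^sup>2)) has_real_derivative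
      integral {0..2 * pi} (\<lambda>x. 2 * (w x t * wt x t))) (at t)"
    using assms by (rule leibniz_positive_times)
  then show ?thesis unfolding energy_def[abs_def] by simp
qed

lemma integral_wx: "t > 0 \<Longrightarrow> ((\<lambda>x. wx x t) has_integral 0) {0..2 * pi}"
  by (rule has_integral_deriv_periodic[where f = "\<lambda>x. w x t", OF der_x per]) auto

lemma integral_wxx: "t > 0 \<Longrightarrow> ((\<lambda>x. wxx x t) has_integral 0) {0..2 * pi}"
  by (rule has_integral_deriv_periodic[where f = "\<lambda>x. wx x t", OF der_xx per_x]) auto

text \<open>The integrand is half the \<open>x\<close>-derivative of \<open>w^2\<close>. Hence the
  transport term drops out of the energy balance, and no bound on its coefficient ever
  enters.\<close>

lemma integral_w_wx:
  assumes "t > 0"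
  shows "((\<lambda>x. w x t * wx x t) has_integral 0) {0..2 * pi}"
proof -
  have "((\<lambda>x. 2 * (w x t * wx x t)) has_integral 0) {0..2 * pi}"
    using assms by (intro has_integral_deriv_periodic[where f = "\<lambda>x. (w x t)\<^sup>2"])
      (auto intro!: derivative_eq_intros der_x simp: per)
  from has_integral_mult_right[OF this, of "1 / 2"] show ?thesis by simp
qed

lemma integral_w_wxx:
  assumes "t > 0"
  shows "((\<lambda>x. w x t * wxx x t) has_integral - dissipation t) {0..2 * pi}"
  using periodic_integration_by_parts[where f = "\<lambda>x. w x t" and g = "\<lambda>x. wx x t",
      OF der_x per der_xx per_x continuous_slice(2)] assms
  by (simp add: dissipation_def power2_eq_square)

lemma mean_constant:
  assumes "\<And>t. t > 0 \<Longrightarrow> integral {0..2 * pi} (\<lambda>x. wt x t) = 0" "0 < s" "0 < t"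
  shows "mean s = mean t"
proof -
  have d: "(mean has_real_derivative 0) (at r)" if "r > 0" for r
    using mean_deriv[OF that] assms(1)[OF that] by simp
  have "mean r' = mean r" if "0 < r" "r < r'" for r r'
  proof (rule DERIV_isconst_end[OF that(2)])
    show "continuous_on {r..r'} mean"
      using that by (intro continuous_at_imp_continuous_on ballI DERIV_isCont[OF d]) auto
  qed (use d that in auto)
  then show ?thesis using assms(2,3) by (cases s t rule: linorder_cases) auto
qed

end

section \<open>The coupled system at one fixed parameter value\<close>

text \<open>For fixed \<open>z\<close> the coefficients are constants: \<open>A\<close>,
  \<open>B\<close> stand for the values of \<open>a\<close>, \<open>b\<close> at \<open>z\<close>,
  and \<alpha>, \<beta> for those of their derivatives. Here \<open>u\<close> is the deviation from
  the steady state 1. Only \<open>b0\<close> and \<open>M\<close> are to appear in the estimates,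
  which makes them uniform in \<open>z\<close>.\<close>

locale sensitivity_energy =
  u: periodic_C21 u ux uxx ut + v: periodic_C21 v vx vxx vt
  for u ux uxx ut v vx vxx vt :: "real \<Rightarrow> real \<Rightarrow> real" +
  fixes A B \<alpha> \<beta> b0 M :: real
  assumes eq_u: "\<And>x t. t > 0 \<Longrightarrow> ut x t = - A * ux x t + B * uxx x t"
    and eq_v: "\<And>x t. t > 0 \<Longrightarrow>
      vt x t = - \<alpha> * ux x t + \<beta> * uxx x t - A * vx x t + B * vxx x t"
    and B: "b0 \<le> B" and b0: "b0 > 0" and M: "\<bar>\<alpha>\<bar> \<le> M" "\<bar>\<beta>\<bar> \<le> M"
begin

lemma mean_u_constant: "0 < s \<Longrightarrow> 0 < t \<Longrightarrow> u.mean s = u.mean t"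
proof (rule u.mean_constant)
  fix t :: real assume t: "t > 0"
  have "((\<lambda>x. - A * ux x t + B * uxx x t) has_integral - A * 0 + B * 0) {0..2 * pi}"
    using t by (intro has_integral_add has_integral_mult_right u.integral_wx u.integral_wxx)
  then show "integral {0..2 * pi} (\<lambda>x. ut x t) = 0"
    using t by (simp add: eq_u integral_unique)
qed

lemma mean_v_constant: "0 < s \<Longrightarrow> 0 < t \<Longrightarrow> v.mean s = v.mean t"
proof (rule v.mean_constant)
  fix t :: real assume t: "t > 0"
  have "((\<lambda>x. - \<alpha> * ux x t + \<beta> * uxx x t - A * vx x t + B * vxx x t) has_integral
      - \<alpha> * 0 + \<beta> * 0 - A * 0 + B * 0) {0..2 * pi}"
    using t by (intro has_integral_add has_integral_diff has_integral_mult_right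
        u.integral_wx u.integral_wxx v.integral_wx v.integral_wxx)
  then show "integral {0..2 * pi} (\<lambda>x. vt x t) = 0"
    using t by (simp add: eq_v integral_unique)
qed

lemma u_energy_deriv:
  assumes t: "t > 0"
  shows "(u.energy has_real_derivative - 2 * B * u.dissipation t) (at t)"
proof -
  have "((\<lambda>x. - A * (u x t * ux x t) + B * (u x t * uxx x t)) has_integral
      - A * 0 + B * - u.dissipation t) {0..2 * pi}"
    using t by (intro has_integral_add has_integral_mult_right u.integral_w_wx u.integral_w_wxx)
  moreover have "u x t * ut x t = - A * (u x t * ux x t) + B * (u x t * uxx x t)" for x
    using t by (simp add: eq_u algebra_simps)
  ultimately show ?thesis using u.energy_deriv[OF t] by (simp add: integral_unique mult.assoc)
qed

text \<open>Integration by parts moves one derivative from \<open>u\<close> onto \<open>v\<close> in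
  the coupling terms. This removes \<open>uxx\<close>, which the dissipation does not control, and
  leaves \<open>u\<close> and \<open>ux\<close>, which it does.\<close>

lemma v_energy_deriv:
  assumes t: "t > 0"
  shows "(v.energy has_real_derivative - 2 * B * v.dissipation t
      + 2 * integral {0..2 * pi} (\<lambda>x. vx x t * (\<alpha> * u x t - \<beta> * ux x t))) (at t)"
proof -
  let ?I1 = "integral {0..2 * pi} (\<lambda>x. vx x t * u x t)"
    and ?I2 = "integral {0..2 * pi} (\<lambda>x. vx x t * ux x t)"
  have 1: "((\<lambda>x. v x t * ux x t) has_integral - ?I1) {0..2 * pi}"
    using t by (intro periodic_integration_by_parts u.der_x v.der_x u.per v.per v.continuous_slice) auto
  have 2: "((\<lambda>x. v x t * uxx x t) has_integral - ?I2) {0..2 * pi}"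
    using t by (intro periodic_integration_by_parts u.der_xx v.der_x u.per_x v.per v.continuous_slice) auto
  have "((\<lambda>x. - \<alpha> * (v x t * ux x t) + \<beta> * (v x t * uxx x t) - A * (v x t * vx x t)
        + B * (v x t * vxx x t)) has_integral
      - \<alpha> * - ?I1 + \<beta> * - ?I2 - A * 0 + B * - v.dissipation t) {0..2 * pi}"
    using t by (intro has_integral_add has_integral_diff has_integral_mult_right 1 2
        v.integral_w_wx v.integral_w_wxx)
  moreover have "v x t * vt x t = - \<alpha> * (v x t * ux x t) + \<beta> * (v x t * uxx x t)
      - A * (v x t * vx x t) + B * (v x t * vxx x t)" for x
    using t by (simp add: eq_v algebra_simps)
  ultimately have L: "integral {0..2 * pi} (\<lambda>x. v x t * vt x t)
      = \<alpha> * ?I1 - \<beta> * ?I2 - B * v.dissipation t"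
    by (simp add: integral_unique)
  have int: "(\<lambda>x. vx x t * u x t) integrable_on {0..2 * pi}" "(\<lambda>x. vx x t * ux x t) integrable_on {0..2 * pi}"
    using t by (auto intro!: integrable_continuous_real continuous_intros u.continuous_slice v.continuous_slice)
  have "((\<lambda>x. \<alpha> * (vx x t * u x t) - \<beta> * (vx x t * ux x t)) has_integral \<alpha> * ?I1 - \<beta> * ?I2) {0..2 * pi}"
    using int by (intro has_integral_diff has_integral_mult_right integrable_integral)
  moreover have "vx x t * (\<alpha> * u x t - \<beta> * ux x t) = \<alpha> * (vx x t * u x t) - \<beta> * (vx x t * ux x t)" for x
    by (simp add: algebra_simps)
  ultimately have "integral {0..2 * pi} (\<lambda>x. vx x t * (\<alpha> * u x t - \<beta> * ux x t)) = \<alpha> * ?I1 - \<beta> * ?I2"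
    by (simp add: integral_unique)
  then show ?thesis using v.energy_deriv[OF t] L by (simp add: right_diff_distrib add.commute mult.assoc)
qed

text \<open>Young's inequality with weight \<eta> separates \<open>vx\<close> from \<open>u\<close>
  and \<open>ux\<close>. Wirtinger's inequality then absorbs the energy of \<open>u\<close> into its
  dissipation, which turns \<open>2 * M^2\<close> into \<open>4 * M^2\<close>.\<close>

lemma coupling_bound:
  assumes t: "t > 0" and mean: "u.mean t = 0" and \<eta>: "\<eta> > 0"
  shows "2 * integral {0..2 * pi} (\<lambda>x. vx x t * (\<alpha> * u x t - \<beta> * ux x t))
    \<le> \<eta> * v.dissipation t + 4 * M\<^sup>2 / \<eta> * u.dissipation t"
proof -
  have pt: "2 * (vx x t * (\<alpha> * u x t - \<beta> * ux x t))
      \<le> \<eta> * (vx x t)\<^sup>2 + 2 * M\<^sup>2 / \<eta> * ((u x t)\<^sup>2 + (ux x t)\<^sup>2)" for x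
  proof -
    let ?X = "vx x t" and ?Y = "\<alpha> * u x t - \<beta> * ux x t"
    have "0 \<le> (\<eta> * ?X - ?Y)\<^sup>2 / \<eta>" using \<eta> by simp
    also have "\<dots> = \<eta> * ?X\<^sup>2 - 2 * (?X * ?Y) + ?Y\<^sup>2 / \<eta>"
      using \<eta> by (simp add: power2_eq_square field_simps)
    finally have 1: "2 * (?X * ?Y) \<le> \<eta> * ?X\<^sup>2 + ?Y\<^sup>2 / \<eta>" by simp
    \<comment> \<open>Adding the square of the sum invokes the parallelogram identity and eliminates
      the mixed product.\<close>
    have "?Y\<^sup>2 \<le> ?Y\<^sup>2 + (\<alpha> * u x t + \<beta> * ux x t)\<^sup>2" by simp
    also have "\<dots> = 2 * (\<alpha>\<^sup>2 * (u x t)\<^sup>2 + \<beta>\<^sup>2 * (ux x t)\<^sup>2)"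
      by (simp add: power2_eq_square algebra_simps)
    also have "\<dots> \<le> 2 * (M\<^sup>2 * (u x t)\<^sup>2 + M\<^sup>2 * (ux x t)\<^sup>2)"
      using M by (intro mult_left_mono add_mono mult_right_mono) (auto simp flip: abs_le_square_iff)
    finally have "?Y\<^sup>2 / \<eta> \<le> 2 * (M\<^sup>2 * (u x t)\<^sup>2 + M\<^sup>2 * (ux x t)\<^sup>2) / \<eta>"
      using \<eta> by (intro divide_right_mono) auto
    then show ?thesis using 1 by (simp add: algebra_simps add_divide_distrib)
  qed
  note intros = integrable_continuous_real continuous_intros u.continuous_slice v.continuous_slice
  have "((\<lambda>x. \<eta> * (vx x t)\<^sup>2 + 2 * M\<^sup>2 / \<eta> * ((u x t)\<^sup>2 + (ux x t)\<^sup>2)) has_integral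
      \<eta> * v.dissipation t + 2 * M\<^sup>2 / \<eta> * (u.energy t + u.dissipation t)) {0..2 * pi}"
    unfolding u.energy_def u.dissipation_def v.dissipation_def
    using t by (intro has_integral_add has_integral_mult_right integrable_integral intros) 
  moreover have "((\<lambda>x. 2 * (vx x t * (\<alpha> * u x t - \<beta> * ux x t))) has_integral
      2 * integral {0..2 * pi} (\<lambda>x. vx x t * (\<alpha> * u x t - \<beta> * ux x t))) {0..2 * pi}"
    using t by (intro has_integral_mult_right integrable_integral intros)
  ultimately have "2 * integral {0..2 * pi} (\<lambda>x. vx x t * (\<alpha> * u x t - \<beta> * ux x t))
      \<le> \<eta> * v.dissipation t + 2 * M\<^sup>2 / \<eta> * (u.energy t + u.dissipation t)"
    using pt by (meson has_integral_le)
  also have "\<dots> \<le> \<eta> * v.dissipation t + 2 * M\<^sup>2 / \<eta> * (2 * u.dissipation t)"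
    using u.energy_le_dissipation[OF t mean] \<eta> by (intro add_left_mono mult_left_mono) auto
  finally show ?thesis by simp
qed

lemma energy_decay:
  assumes st: "0 < s" "s \<le> t" and mean: "\<And>t. t > 0 \<Longrightarrow> u.mean t = 0" "\<And>t. t > 0 \<Longrightarrow> v.mean t = 0"
  shows "u.energy t \<le> exp (- (2 * b0) * (t - s)) * u.energy s"
    and "v.energy t \<le> exp 1 * exp (- (2 * b0) * (t - s))
      * (v.energy s + 4 * M\<^sup>2 * (1 / (2 * b0) + (t - s))\<^sup>2 * u.energy s)"
proof -
  have 1: "- 2 * B * u.dissipation r \<le> - (2 * b0) * u.dissipation r" for r
    using B u.dissipation_nonneg[of r] by (simp add: mult_right_mono)
  have 2: "- 2 * B * v.dissipation r
      + 2 * integral {0..2 * pi} (\<lambda>x. vx x r * (\<alpha> * u x r - \<beta> * ux x r))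
      \<le> - (2 * b0 - \<eta>) * v.energy r + 4 * M\<^sup>2 / \<eta> * u.dissipation r"
    if "s \<le> r" "0 < \<eta>" "\<eta> \<le> 2 * b0" for r \<eta>
  proof -
    have r: "r > 0" using st that by simp
    \<comment> \<open>Because \<open>\<eta> \<le> 2 * b0\<close>, the coefficient is nonnegative and
      Wirtinger's inequality for \<open>v\<close> keeps its direction. The remaining \<eta> times
      the dissipation absorbs the coupling term.\<close>
    have "(2 * b0 - \<eta>) * v.energy r \<le> (2 * b0 - \<eta>) * v.dissipation r"
      using that r mean by (intro mult_left_mono v.energy_le_dissipation) auto
    moreover have "2 * b0 * v.dissipation r \<le> 2 * B * v.dissipation r"
      using B v.dissipation_nonneg[of r] by (intro mult_right_mono) auto
    ultimately show ?thesis
      using coupling_bound[OF r mean(1)[OF r] \<open>0 < \<eta>\<close>] by (simp add: algebra_simps)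
  qed
  have pos: "r > 0" if "s \<le> r" for r using that st by simp
  \<comment> \<open>The second \<open>OF\<close> discharges the positivity of times
    \<open>r \<ge> s\<close> and the vanishing mean that the energy lemmas demand.\<close>
  note E = energy_gronwall[where k = "2 * b0" and s = s and t = t and Eu = u.energy and Ev = v.energy
      and Pu = u.dissipation and N = "4 * M\<^sup>2", OF _ st(2) u_energy_deriv v_energy_deriv 1 2
      u.energy_le_dissipation u.energy_nonneg v.energy_nonneg, OF _ pos pos _ _ _ pos mean(1)[OF pos]]
  show "u.energy t \<le> exp (- (2 * b0) * (t - s)) * u.energy s"
    and "v.energy t \<le> exp 1 * exp (- (2 * b0) * (t - s))
      * (v.energy s + 4 * M\<^sup>2 * (1 / (2 * b0) + (t - s))\<^sup>2 * u.energy s)"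
    using E b0 by simp_all
qed

end

text \<open>Here \<tau> stands for the elapsed time \<open>t - s\<close>. It is replaced by
  \<open>t\<close> in the polynomial factor but kept in the exponential, where the limit in
  \<open>s\<close> is treated later. The constant combines \<open>exp 1\<close> from the loss of
  rate with \<open>8 * M^2\<close>, the 2 coming from
  \<open>(x + y)^2 \<le> 2 * (x^2 + y^2)\<close>.\<close>

lemma combined_decay_bound:
  fixes Eu Ev Eus Evs M k t \<tau> :: real
  assumes k: "k > 0" and \<tau>: "0 \<le> \<tau>" "\<tau> \<le> t" and nn: "0 \<le> Eus" "0 \<le> Evs"
    and Eu: "Eu \<le> exp (- k * \<tau>) * Eus"
    and Ev: "Ev \<le> exp 1 * exp (- k * \<tau>) * (Evs + 4 * M\<^sup>2 * (1 / k + \<tau>)\<^sup>2 * Eus)"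
  shows "Eu + Ev \<le> exp 1 * (1 + 8 * M\<^sup>2 * (1 / k\<^sup>2 + 1)) * (1 + t\<^sup>2) * exp (- k * \<tau>) * (Eus + Evs)"
proof -
  have "\<tau>\<^sup>2 \<le> t\<^sup>2" using \<tau> by (intro power_mono) auto
  have "(1 / k + \<tau>)\<^sup>2 \<le> (1 / k + \<tau>)\<^sup>2 + (1 / k - \<tau>)\<^sup>2" by simp
  also have "\<dots> = 2 * (1 / k\<^sup>2 + \<tau>\<^sup>2)" by (simp add: power2_eq_square algebra_simps)
  also have "\<dots> \<le> 2 * (1 / k\<^sup>2 + t\<^sup>2)" using \<open>\<tau>\<^sup>2 \<le> t\<^sup>2\<close> by simp
  also have "\<dots> \<le> 2 * ((1 / k\<^sup>2 + 1) * (1 + t\<^sup>2))"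
    by (simp add: algebra_simps add_divide_distrib)
  finally have sq: "(1 / k + \<tau>)\<^sup>2 \<le> 2 * ((1 / k\<^sup>2 + 1) * (1 + t\<^sup>2))" .
  define q where "q = 1 / k\<^sup>2 + 1"
  have "Eus + (Evs + 4 * M\<^sup>2 * (1 / k + \<tau>)\<^sup>2 * Eus)
      \<le> Eus + (Evs + 4 * M\<^sup>2 * (2 * (q * (1 + t\<^sup>2))) * Eus)"
    using sq[folded q_def] nn by (intro add_left_mono mult_right_mono mult_left_mono) auto
  also have "\<dots> \<le> (1 + t\<^sup>2) * (Eus + Evs) + 8 * M\<^sup>2 * q * (1 + t\<^sup>2) * (Eus + Evs)"
  proof -
    have "0 \<le> t\<^sup>2 * (Eus + Evs)" using nn by simp
    moreover have "0 \<le> 8 * M\<^sup>2 * q * (1 + t\<^sup>2) * Evs" using nn by (simp add: q_def)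
    ultimately show ?thesis by (simp add: algebra_simps)
  qed
  finally have 1: "Eus + (Evs + 4 * M\<^sup>2 * (1 / k + \<tau>)\<^sup>2 * Eus)
      \<le> (1 + 8 * M\<^sup>2 * q) * (1 + t\<^sup>2) * (Eus + Evs)"
    by (simp add: algebra_simps)
  have "exp (- k * \<tau>) * Eus \<le> exp 1 * exp (- k * \<tau>) * Eus"
    using nn by (intro mult_right_mono) auto
  then have "Eu + Ev \<le> exp 1 * exp (- k * \<tau>) * (Eus + (Evs + 4 * M\<^sup>2 * (1 / k + \<tau>)\<^sup>2 * Eus))"
    using Eu Ev by (simp only: distrib_left)
  also have "\<dots> \<le> exp 1 * exp (- k * \<tau>) * ((1 + 8 * M\<^sup>2 * q) * (1 + t\<^sup>2) * (Eus + Evs))"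
    using 1 by (intro mult_left_mono) auto
  finally show ?thesis unfolding q_def by (simp only: mult_ac)
qed

section \<open>Square-integrable functions and the initial time\<close>

lemma L2_norm_sq_continuous:
  fixes f :: "real \<Rightarrow> real"
  assumes "continuous_on {0..2 * pi} f"
  shows "L2_norm_sq f = ennreal (integral {0..2 * pi} (\<lambda>x. (f x)\<^sup>2))"
proof -
  have int: "set_integrable lborel {0..2 * pi} (\<lambda>x. (f x)\<^sup>2)"
    using assms by (intro borel_integrable_atLeastAtMost' continuous_intros)
  have "L2_norm_sq f = (\<integral>\<^sup>+ x. ennreal (indicator {0..2 * pi} x *\<^sub>R (f x)\<^sup>2) \<partial>lborel)"
    unfolding L2_norm_sq_def by (intro nn_integral_cong) (auto simp: indicator_def)
  also have "\<dots> = ennreal (LINT x:{0..2 * pi}|lborel. (f x)\<^sup>2)"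
    using int unfolding set_integrable_def set_lebesgue_integral_def
    by (intro nn_integral_eq_integral) auto
  finally show ?thesis using set_borel_integral_eq_integral(2)[OF int] by simp
qed

text \<open>A squared substitute for the triangle inequality, which avoids roots in
  \<open>ennreal\<close>; its factor 2 affects only the final constant.\<close>

lemma L2_norm_sq_add_le:
  fixes f g :: "real \<Rightarrow> real"
  assumes [measurable]: "f \<in> borel_measurable borel" "g \<in> borel_measurable borel"
  shows "L2_norm_sq (\<lambda>x. f x + g x) \<le> 2 * L2_norm_sq f + 2 * L2_norm_sq g"
proof -
  have "(f x + g x)\<^sup>2 \<le> 2 * (f x)\<^sup>2 + 2 * (g x)\<^sup>2" for x
    using zero_le_power2[of "f x - g x"] by (simp add: power2_eq_square algebra_simps)
  then have "ennreal ((f x + g x)\<^sup>2) \<le> 2 * ennreal ((f x)\<^sup>2) + 2 * ennreal ((g x)\<^sup>2)" for x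
    by (simp add: ennreal_leI flip: ennreal_plus ennreal_mult'' ennreal_numeral)
  then have "L2_norm_sq (\<lambda>x. f x + g x) \<le> (\<integral>\<^sup>+ x. 2 * (ennreal ((norm (f x))\<^sup>2) * indicator {0..2 * pi} x)
      + 2 * (ennreal ((norm (g x))\<^sup>2) * indicator {0..2 * pi} x) \<partial>lborel)"
    unfolding L2_norm_sq_def by (intro nn_integral_mono) (auto simp: indicator_def)
  also have "\<dots> = 2 * L2_norm_sq f + 2 * L2_norm_sq g"
    unfolding L2_norm_sq_def by (simp add: nn_integral_add nn_integral_cmult)
  finally show ?thesis .
qed

lemma L2_norm_sq_Pair:
  fixes f g :: "real \<Rightarrow> real"
  assumes [measurable]: "f \<in> borel_measurable borel" "g \<in> borel_measurable borel"
  shows "L2_norm_sq (\<lambda>x. (f x, g x)) = L2_norm_sq f + L2_norm_sq g"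
proof -
  have "L2_norm_sq (\<lambda>x. (f x, g x)) = (\<integral>\<^sup>+ x. ennreal ((norm (f x))\<^sup>2) * indicator {0..2 * pi} x
      + ennreal ((norm (g x))\<^sup>2) * indicator {0..2 * pi} x \<partial>lborel)"
    unfolding L2_norm_sq_def
    by (intro nn_integral_cong) (auto simp: indicator_def norm_Pair simp flip: ennreal_plus)
  then show ?thesis
    unfolding L2_norm_sq_def by (simp add: nn_integral_add)
qed

text \<open>Both claims are the Cauchy-Schwarz inequality for \<open>g\<close> against the indicator
  of the period, whose squared norm is \<open>2 * pi\<close>.\<close>

lemma
  fixes g :: "real \<Rightarrow> real"
  assumes [measurable]: "g \<in> borel_measurable borel" and fin: "L2_norm_sq g < \<infinity>"
  shows set_integrable_L2: "set_integrable lborel {0..2 * pi} g"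
    and set_integral_power2_le: "ennreal ((LBINT x:{0..2 * pi}. g x)\<^sup>2) \<le> ennreal (2 * pi) * L2_norm_sq g"
proof -
  let ?I = "indicator {0..2 * pi} :: real \<Rightarrow> ennreal"
  let ?n = "\<integral>\<^sup>+ x. ennreal (norm (indicator {0..2 * pi} x *\<^sub>R g x)) \<partial>lborel"
  have vol: "(\<integral>\<^sup>+ x. ?I x \<partial>lborel) = ennreal (2 * pi)" by simp
  have n: "?n = (\<integral>\<^sup>+ x. ?I x * (ennreal \<bar>g x\<bar> * ?I x) \<partial>lborel)"
    by (intro nn_integral_cong) (auto simp: indicator_def)
  have "?n\<^sup>2 \<le> (\<integral>\<^sup>+ x. (?I x)\<^sup>2 \<partial>lborel) * (\<integral>\<^sup>+ x. (ennreal \<bar>g x\<bar> * ?I x)\<^sup>2 \<partial>lborel)"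
    unfolding n by (rule Cauchy_Schwarz_nn_integral) auto
  also have "(\<integral>\<^sup>+ x. (?I x)\<^sup>2 \<partial>lborel) = ennreal (2 * pi)"
    unfolding vol[symmetric] by (intro nn_integral_cong) (auto simp: indicator_def)
  also have "(\<integral>\<^sup>+ x. (ennreal \<bar>g x\<bar> * ?I x)\<^sup>2 \<partial>lborel) = L2_norm_sq g"
    unfolding L2_norm_sq_def by (intro nn_integral_cong) (auto simp: indicator_def ennreal_power)
  finally have cs: "?n\<^sup>2 \<le> ennreal (2 * pi) * L2_norm_sq g" .
  also have "\<dots> < \<infinity>" using fin by (simp add: ennreal_mult_less_top)
  finally have "?n < \<infinity>" by (simp add: power_less_top_ennreal)
  then show int: "set_integrable lborel {0..2 * pi} g"
    unfolding set_integrable_def integrable_iff_bounded by simp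
  have "ennreal (norm (LBINT x:{0..2 * pi}. g x)) \<le> ?n"
    using int unfolding set_integrable_def set_lebesgue_integral_def by (rule integral_norm_bound_ennreal)
  then have "(ennreal (norm (LBINT x:{0..2 * pi}. g x)))\<^sup>2 \<le> ?n\<^sup>2" by (rule power_mono) simp
  then show "ennreal ((LBINT x:{0..2 * pi}. g x)\<^sup>2) \<le> ennreal (2 * pi) * L2_norm_sq g"
    using cs by (simp add: ennreal_power)
qed

text \<open>Integration over a period is continuous in the L2 norm. The filter is left general to
  serve two limits: difference quotients in the parameter, and times decreasing to 0.\<close>

lemma set_integral_L2_limit:
  fixes f :: "real \<Rightarrow> real" and g :: "'i \<Rightarrow> real \<Rightarrow> real"
  assumes F: "F \<noteq> bot" and lim: "((\<lambda>n. L2_norm_sq (\<lambda>x. g n x - f x)) \<longlongrightarrow> 0) F"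
    and g: "\<forall>\<^sub>F n in F. g n \<in> borel_measurable borel \<and> (LBINT x:{0..2 * pi}. g n x) = m"
    and f: "f \<in> borel_measurable borel" "L2_norm_sq f < \<infinity>"
  shows "(LBINT x:{0..2 * pi}. f x) = m"
proof -
  let ?c = "m - (LBINT x:{0..2 * pi}. f x)"
  \<comment> \<open>Convergence to 0 makes the norms eventually finite, hence the differences
    integrable, so the integral splits.\<close>
  have "\<forall>\<^sub>F n in F. ennreal (?c\<^sup>2) \<le> ennreal (2 * pi) * L2_norm_sq (\<lambda>x. g n x - f x)"
    using g order_tendstoD(2)[OF lim ennreal_zero_less_top]
  proof eventually_elim
    case (elim n)
    then have meas: "(\<lambda>x. g n x - f x) \<in> borel_measurable borel" using f by auto
    have i: "set_integrable lborel {0..2 * pi} (\<lambda>x. g n x - f x)"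
      "set_integrable lborel {0..2 * pi} f"
      using set_integrable_L2 meas f elim by auto
    have "(LBINT x:{0..2 * pi}. (g n x - f x) + f x)
        = (LBINT x:{0..2 * pi}. g n x - f x) + (LBINT x:{0..2 * pi}. f x)"
      using i by (rule set_integral_add)
    then have "(LBINT x:{0..2 * pi}. g n x - f x) = ?c" using elim by simp
    then show ?case using set_integral_power2_le[OF meas] elim by simp
  qed
  moreover have "((\<lambda>n. ennreal (2 * pi) * L2_norm_sq (\<lambda>x. g n x - f x)) \<longlongrightarrow> ennreal (2 * pi) * 0) F"
    using lim by (intro ennreal_tendsto_cmult) auto
  ultimately have "ennreal (?c\<^sup>2) \<le> ennreal (2 * pi) * 0"
    using F tendsto_lowerbound by blast
  then show ?thesis by simp
qed

section \<open>From the solution class to the energy setting, and the limit at the initial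
  time\<close>

lemma parabolic_class_periodic_C21:
  assumes "parabolic_class f"
  shows "periodic_C21 (\<lambda>x t. f x z t - c) (\<lambda>x t. dx f x z t) (\<lambda>x t. dx (dx f) x z t) (\<lambda>x t. dt f x z t)"
proof
  note f = assms[unfolded parabolic_class_def]
  have D: "(g has_real_derivative deriv g x) (at x)" if "g differentiable (at x)"
    for g :: "real \<Rightarrow> real" and x
    using that DERIV_deriv_iff_real_differentiable by blast
  fix x t :: real assume t: "t > 0"
  show "((\<lambda>s. f s z t - c) has_real_derivative dx f x z t) (at x)"
    using f t D[of "\<lambda>s. f s z t" x] unfolding dx_def[of f]
    by (auto intro!: derivative_eq_intros)
  show "((\<lambda>s. dx f s z t) has_real_derivative dx (dx f) x z t) (at x)"
    using f t D[of "\<lambda>s. dx f s z t" x] unfolding dx_def[of "dx f"] by auto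
  show "((\<lambda>t. f x z t - c) has_real_derivative dt f x z t) (at t)"
    using f t D[of "\<lambda>s. f x z s" t] unfolding dt_def
    by (auto intro!: derivative_eq_intros)
  show "f (x + 2 * pi) z t - c = f x z t - c"
    using f t unfolding L2_torus_def by (auto dest: less_imp_le)
next
  have c: "continuous_on (UNIV \<times> {0<..}) (\<lambda>(x, t). g x z t)" if "g \<in> {f, dx f, dx (dx f), dt f}" for g
    using assms that unfolding parabolic_class_def by blast
  show "continuous_on (UNIV \<times> {0<..}) (\<lambda>(x, t). f x z t - c)"
    using c[of f] unfolding case_prod_unfold by (intro continuous_intros) auto
  show "continuous_on (UNIV \<times> {0<..}) (\<lambda>(x, t). dx f x z t)"
    "continuous_on (UNIV \<times> {0<..}) (\<lambda>(x, t). dx (dx f) x z t)"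
    "continuous_on (UNIV \<times> {0<..}) (\<lambda>(x, t). dt f x z t)"
    using c by auto
qed

text \<open>By normalization the mean of the datum of \<open>u\<close> is the same for every
  parameter value. All its difference quotients thus have mean zero, and so does their L2
  limit.\<close>

lemma mean_v_initial:
  assumes sol: "sensitivity_solution a b u v" and norm: "normalized u"
  shows "(LBINT x:{0..2 * pi}. v x z 0) = 0"
proof -
  have L2: "(\<lambda>x. u x z' 0) \<in> borel_measurable borel" "L2_norm_sq (\<lambda>x. u x z' 0) < \<infinity>"
    "(\<lambda>x. v x z' 0) \<in> borel_measurable borel" "L2_norm_sq (\<lambda>x. v x z' 0) < \<infinity>" for z'
    using sol unfolding sensitivity_solution_def parabolic_class_def L2_torus_def by auto
  have mean: "(LBINT x:{0..2 * pi}. u x z' 0) = 2 * pi" for z'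
    using norm by (simp add: normalized_def field_simps)
  show ?thesis
  proof (rule set_integral_L2_limit[where F = "at 0" and g = "\<lambda>h x. (u x (z + h) 0 - u x z 0) / h"])
    show "((\<lambda>h. L2_norm_sq (\<lambda>x. (u x (z + h) 0 - u x z 0) / h - v x z 0)) \<longlongrightarrow> 0) (at 0)"
      using sol by (simp add: sensitivity_solution_def parameter_derivative_def)
    have "(LBINT x:{0..2 * pi}. (u x (z + h) 0 - u x z 0) / h) = 0" for h
      using set_integral_diff(2)[OF set_integrable_L2[OF L2(1,2)] set_integrable_L2[OF L2(1,2)], of "z + h" z] mean
      by simp
    then show "\<forall>\<^sub>F h in at 0. (\<lambda>x. (u x (z + h) 0 - u x z 0) / h) \<in> borel_measurable borel \<and>
        (LBINT x:{0..2 * pi}. (u x (z + h) 0 - u x z 0) / h) = 0"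
      using L2(1) by (intro always_eventually) auto
  qed (use L2 in auto)
qed

text \<open>The equations conserve the mean only among positive times; attainment of the datum in L2
  connects it with time 0. The uses are \<open>c = 1\<close> for \<open>u\<close> and
  \<open>c = 0\<close> for \<open>v\<close>.\<close>

lemma parabolic_mean:
  assumes f: "parabolic_class f"
    and const: "\<And>s t. 0 < s \<Longrightarrow> 0 < t \<Longrightarrow>
      integral {0..2 * pi} (\<lambda>x. f x z s - c) = integral {0..2 * pi} (\<lambda>x. f x z t - c)"
    and init: "(LBINT x:{0..2 * pi}. f x z 0) = 2 * pi * c" and t: "t > 0"
  shows "integral {0..2 * pi} (\<lambda>x. f x z t - c) = 0"
proof -
  have L2: "(\<lambda>x. f x z s) \<in> borel_measurable borel" "L2_norm_sq (\<lambda>x. f x z s) < \<infinity>" if "s \<ge> 0" for s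
    using f that unfolding parabolic_class_def L2_torus_def by auto
  have int: "((\<lambda>x. f x z s - c) has_integral (LBINT x:{0..2 * pi}. f x z s) - 2 * pi * c) {0..2 * pi}"
    if "s \<ge> 0" for s
  proof -
    note i = set_borel_integral_eq_integral[OF set_integrable_L2[OF L2[OF that]]]
    have "((\<lambda>x. c) has_integral 2 * pi * c) {0..2 * pi}"
      using has_integral_const_real[of c 0 "2 * pi"] by simp
    then show ?thesis using i by (intro has_integral_diff) (auto simp: has_integral_integral)
  qed
  let ?m = "integral {0..2 * pi} (\<lambda>x. f x z t - c) + 2 * pi * c"
  have "(LBINT x:{0..2 * pi}. f x z 0) = ?m"
  proof (rule set_integral_L2_limit[where F = "at_right 0" and g = "\<lambda>s x. f x z s"])
    show "((\<lambda>s. L2_norm_sq (\<lambda>x. f x z s - f x z 0)) \<longlongrightarrow> 0) (at_right 0)"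
      using f by (simp add: parabolic_class_def)
    show "\<forall>\<^sub>F s in at_right 0. (\<lambda>x. f x z s) \<in> borel_measurable borel \<and>
        (LBINT x:{0..2 * pi}. f x z s) = ?m"
      using eventually_at_right_less[of 0]
    proof eventually_elim
      case (elim s)
      then show ?case using L2(1)[of s] integral_unique[OF int[of s]] const[OF elim t] by simp
    qed
  qed (use L2 in auto)
  then show ?thesis using init by simp
qed

lemma parabolic_initial_bound:
  assumes f: "parabolic_class f" and s: "s \<ge> 0"
  shows "L2_norm_sq (\<lambda>x. f x z s - c)
    \<le> 2 * L2_norm_sq (\<lambda>x. f x z 0 - c) + 2 * L2_norm_sq (\<lambda>x. f x z s - f x z 0)"
proof -
  have [measurable]: "(\<lambda>x. f x z s) \<in> borel_measurable borel" "(\<lambda>x. f x z 0) \<in> borel_measurable borel"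
    using f s unfolding parabolic_class_def L2_torus_def by auto
  show ?thesis
    using L2_norm_sq_add_le[of "\<lambda>x. f x z 0 - c" "\<lambda>x. f x z s - f x z 0"] by simp
qed

text \<open>The energy decay from \<open>s\<close> to \<open>t\<close> is combined with a comparison
  of the states at times \<open>s\<close> and 0, and \<open>s\<close> then tends to 0. The constant
  depends on \<open>z\<close> only through the bounds \<open>b0\<close> and
  \<open>M\<close>.\<close>

lemma pointwise_decay:
  assumes sol: "sensitivity_solution a b u v" and norm: "normalized u"
    and b0: "b0 > 0" "b0 \<le> b z" and M: "\<bar>deriv a z\<bar> \<le> M" "\<bar>deriv b z\<bar> \<le> M" and t: "t > 0"
  shows "L2_norm_sq (\<lambda>x. (u x z t, v x z t) - (1, 0))
    \<le> ennreal (4 * (exp 1 * (1 + 8 * M\<^sup>2 * (1 / (2 * b0)\<^sup>2 + 1))) * (1 + t\<^sup>2) * exp (- 2 * b0 * t))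
      * L2_norm_sq (\<lambda>x. (u x z 0, v x z 0) - (1, 0))"
proof -
  have pu: "parabolic_class u" and pv: "parabolic_class v"
    using sol by (auto simp: sensitivity_solution_def)
  interpret sensitivity_energy "\<lambda>x t. u x z t - 1" "\<lambda>x t. dx u x z t" "\<lambda>x t. dx (dx u) x z t"
    "\<lambda>x t. dt u x z t" "\<lambda>x t. v x z t" "\<lambda>x t. dx v x z t" "\<lambda>x t. dx (dx v) x z t"
    "\<lambda>x t. dt v x z t" "a z" "b z" "deriv a z" "deriv b z" b0 M
  proof (intro sensitivity_energy.intro sensitivity_energy_axioms.intro)
    show "periodic_C21 (\<lambda>x t. u x z t - 1) (\<lambda>x t. dx u x z t) (\<lambda>x t. dx (dx u) x z t) (\<lambda>x t. dt u x z t)"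
      using pu by (rule parabolic_class_periodic_C21)
    show "periodic_C21 (\<lambda>x t. v x z t) (\<lambda>x t. dx v x z t) (\<lambda>x t. dx (dx v) x z t) (\<lambda>x t. dt v x z t)"
      using parabolic_class_periodic_C21[OF pv, of z 0] by simp
    fix x s :: real assume "s > 0"
    with sol show "dt u x z s = - a z * dx u x z s + b z * dx (dx u) x z s"
      and "dt v x z s = - deriv a z * dx u x z s + deriv b z * dx (dx u) x z s
        - a z * dx v x z s + b z * dx (dx v) x z s"
      unfolding sensitivity_solution_def by blast+
  qed (use b0 M in auto)
  have mu: "u.mean s = 0" if "s > 0" for s
    unfolding u.mean_def
  proof (rule parabolic_mean[OF pu mean_u_constant[unfolded u.mean_def] _ that])
    show "(LBINT x:{0..2 * pi}. u x z 0) = 2 * pi * 1"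
      using norm by (simp add: normalized_def field_simps)
  qed
  have mv: "v.mean s = 0" if "s > 0" for s
    using parabolic_mean[where c = 0, OF pv, simplified,
        OF mean_v_constant[unfolded v.mean_def] mean_v_initial[OF sol norm] that]
    by (simp add: v.mean_def)
  have pair: "L2_norm_sq (\<lambda>x. (u x z s, v x z s) - (1, 0))
      = L2_norm_sq (\<lambda>x. u x z s - 1) + L2_norm_sq (\<lambda>x. v x z s)" if "s \<ge> 0" for s
  proof -
    have [measurable]: "(\<lambda>x. u x z s) \<in> borel_measurable borel" "(\<lambda>x. v x z s) \<in> borel_measurable borel"
      using pu pv that unfolding parabolic_class_def L2_torus_def by auto
    show ?thesis using L2_norm_sq_Pair[of "\<lambda>x. u x z s - 1" "\<lambda>x. v x z s"] by simp
  qed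
  have E: "L2_norm_sq (\<lambda>x. (u x z s, v x z s) - (1, 0)) = ennreal (u.energy s + v.energy s)" if "s > 0" for s
    using that pair[of s] u.continuous_slice(1)[OF that] v.continuous_slice(1)[OF that]
    by (simp add: L2_norm_sq_continuous u.energy_def v.energy_def
        u.energy_nonneg[unfolded u.energy_def] v.energy_nonneg[unfolded v.energy_def])
  define D where "D = exp 1 * (1 + 8 * M\<^sup>2 * (1 / (2 * b0)\<^sup>2 + 1))"
  have D: "D \<ge> 0" unfolding D_def by (intro mult_nonneg_nonneg add_nonneg_nonneg) auto
  \<comment> \<open>The factor 2 dominates \<open>exp (2 * b0 * s)\<close> for small
    \<open>s\<close>. A second factor 2, from comparing with the datum, leads to the 4 in the
    claim.\<close>
  define K where "K = 2 * D * (1 + t\<^sup>2) * exp (- 2 * b0 * t)"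
  have K: "K \<ge> 0" using D unfolding K_def by (intro mult_nonneg_nonneg add_nonneg_nonneg) auto
  \<comment> \<open>The defect between the states at times \<open>s\<close> and 0; it vanishes in
    the limit because the data are attained in L2.\<close>
  define \<delta> where "\<delta> s = L2_norm_sq (\<lambda>x. u x z s - u x z 0) + L2_norm_sq (\<lambda>x. v x z s - v x z 0)" for s
  let ?E0 = "L2_norm_sq (\<lambda>x. (u x z 0, v x z 0) - (1, 0))"
  have "((\<lambda>s. exp (2 * b0 * s)) \<longlongrightarrow> exp (2 * b0 * 0)) (at_right 0)"
    by (intro tendsto_intros)
  then have "\<forall>\<^sub>F s in at_right 0. exp (2 * b0 * s) < 2"
    by (intro order_tendstoD(2)) auto
  moreover have "\<forall>\<^sub>F s in at_right 0. s \<in> {0<..<t}"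
    using t by (rule eventually_at_right_real)
  ultimately have "\<forall>\<^sub>F s in at_right 0. L2_norm_sq (\<lambda>x. (u x z t, v x z t) - (1, 0))
      \<le> ennreal K * (2 * ?E0 + 2 * \<delta> s)"
  proof eventually_elim
    case (elim s)
    then have s: "0 < s" "s \<le> t" "0 \<le> s" by auto
    have "u.energy t + v.energy t \<le> D * (1 + t\<^sup>2) * exp (- (2 * b0) * (t - s)) * (u.energy s + v.energy s)"
      unfolding D_def using energy_decay[OF s(1,2) mu mv] b0 s
      by (intro combined_decay_bound u.energy_nonneg v.energy_nonneg) auto
    also have "\<dots> \<le> K * (u.energy s + v.energy s)"
    proof (intro mult_right_mono add_nonneg_nonneg u.energy_nonneg v.energy_nonneg)
      have "exp (- (2 * b0) * (t - s)) = exp (- 2 * b0 * t) * exp (2 * b0 * s)"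
        by (simp add: algebra_simps flip: exp_add)
      also have "\<dots> \<le> exp (- 2 * b0 * t) * 2" using elim by (intro mult_left_mono) auto
      finally have "D * (1 + t\<^sup>2) * exp (- (2 * b0) * (t - s)) \<le> D * (1 + t\<^sup>2) * (exp (- 2 * b0 * t) * 2)"
        using D by (intro mult_left_mono) auto
      then show "D * (1 + t\<^sup>2) * exp (- (2 * b0) * (t - s)) \<le> K"
        unfolding K_def by (simp only: mult_ac)
    qed
    finally have "L2_norm_sq (\<lambda>x. (u x z t, v x z t) - (1, 0)) \<le> ennreal (K * (u.energy s + v.energy s))"
      unfolding E[OF t] by (rule ennreal_leI)
    also have "\<dots> = ennreal K * ennreal (u.energy s + v.energy s)"
      using K u.energy_nonneg v.energy_nonneg by (intro ennreal_mult add_nonneg_nonneg)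
    also have "ennreal (u.energy s + v.energy s) = L2_norm_sq (\<lambda>x. u x z s - 1) + L2_norm_sq (\<lambda>x. v x z s)"
      using E[OF s(1)] pair[OF s(3)] by simp
    also have "\<dots> \<le> (2 * L2_norm_sq (\<lambda>x. u x z 0 - 1) + 2 * L2_norm_sq (\<lambda>x. u x z s - u x z 0))
        + (2 * L2_norm_sq (\<lambda>x. v x z 0) + 2 * L2_norm_sq (\<lambda>x. v x z s - v x z 0))"
      using parabolic_initial_bound[OF pu s(3), of z 1] parabolic_initial_bound[OF pv s(3), of z 0]
      by (intro add_mono) simp_all
    also have "\<dots> = 2 * ?E0 + 2 * \<delta> s"
      unfolding pair[OF order_refl] \<delta>_def by (simp add: distrib_left ac_simps)
    finally show ?case by (simp add: mult_left_mono)
  qed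
  moreover have "((\<lambda>s. ennreal K * (2 * ?E0 + 2 * \<delta> s)) \<longlongrightarrow> ennreal K * (2 * ?E0 + 2 * (0 + 0))) (at_right 0)"
    using pu pv unfolding \<delta>_def parabolic_class_def
    by (intro ennreal_tendsto_cmult tendsto_add tendsto_const) auto
  ultimately have "L2_norm_sq (\<lambda>x. (u x z t, v x z t) - (1, 0)) \<le> ennreal K * (2 * ?E0 + 2 * (0 + 0))"
    using tendsto_lowerbound trivial_limit_at_right_real by blast
  also have "\<dots> = ennreal (2 * K) * ?E0"
    using K by (simp add: ennreal_mult mult_ac)
  also have "2 * K = 4 * D * (1 + t\<^sup>2) * exp (- 2 * b0 * t)" by (simp add: K_def)
  finally show ?thesis unfolding D_def .
qed

theorem theorem3p1:
  fixes a b :: "real \<Rightarrow> real" and b0 :: real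
  assumes "a C1_differentiable_on UNIV" and "b C1_differentiable_on UNIV"
    and "bdd_below (range b)" and "b0 = (INF z. b z)" and "b0 > 0"
    and "bounded (range (deriv a))" and "bounded (range (deriv b))"
  shows "\<exists>C>0. \<forall>u v. sensitivity_solution a b u v \<and> normalized u \<longrightarrow>
    (\<forall>t\<ge>0. (SUP z. L2_norm_sq (\<lambda>x. (u x z t, v x z t) - (1, 0)))
       \<le> ennreal (C * (1 + t\<^sup>2) * exp (- 2 * b0 * t))
          * (SUP z. L2_norm_sq (\<lambda>x. (u x z 0, v x z 0) - (1, 0))))"
proof -
  obtain Ma Mb where Ma: "\<And>z. \<bar>deriv a z\<bar> \<le> Ma" and Mb: "\<And>z. \<bar>deriv b z\<bar> \<le> Mb"
    using assms(6,7) unfolding bounded_iff by auto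
  define M where "M = max Ma Mb"
  have M: "\<bar>deriv a z\<bar> \<le> M" "\<bar>deriv b z\<bar> \<le> M" for z
    using Ma[of z] Mb[of z] by (auto simp: M_def)
  have b: "b0 \<le> b z" for z
    using assms(3,4) by (auto intro: cINF_lower)
  define C where "C = 4 * (exp 1 * (1 + 8 * M\<^sup>2 * (1 / (2 * b0)\<^sup>2 + 1)))"
  \<comment> \<open>At \<open>t = 0\<close>, which \<open>pointwise_decay\<close> leaves out, the
    claim reduces to multiplication by \<open>C\<close>, so \<open>C \<ge> 1\<close> is what that
    case requires.\<close>
  have "1 \<le> exp 1 * (1 + 8 * M\<^sup>2 * (1 / (2 * b0)\<^sup>2 + 1))"
    using mult_mono[of 1 "exp 1" 1 "1 + 8 * M\<^sup>2 * (1 / (2 * b0)\<^sup>2 + 1)"] by simp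
  then have C: "C \<ge> 1" by (simp add: C_def)
  show ?thesis
  proof (intro exI[of _ C] conjI allI impI SUP_least)
    show "C > 0" using C by simp
    fix u v and t z :: real
    assume sol: "sensitivity_solution a b u v \<and> normalized u" and t: "t \<ge> 0"
    let ?E = "\<lambda>z t. L2_norm_sq (\<lambda>x. (u x z t, v x z t) - (1, 0))"
    have "?E z t \<le> ennreal (C * (1 + t\<^sup>2) * exp (- 2 * b0 * t)) * ?E z 0"
    proof (cases "t = 0")
      case True
      have "1 * ?E z 0 \<le> ennreal C * ?E z 0"
        using C by (intro mult_right_mono) (auto simp flip: ennreal_1 intro: ennreal_leI)
      then show ?thesis using True by simp
    next
      case False
      then show ?thesis
        using sol t pointwise_decay[of a b u v b0 z M t] assms(5) b M unfolding C_def by simp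
    qed
    also have "\<dots> \<le> ennreal (C * (1 + t\<^sup>2) * exp (- 2 * b0 * t)) * (SUP z. ?E z 0)"
      by (intro mult_left_mono SUP_upper) auto
    finally show "?E z t \<le> ennreal (C * (1 + t\<^sup>2) * exp (- 2 * b0 * t)) * (SUP z. ?E z 0)" .
  qed
qed

end
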